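(* Let $A\in \mathrm{GL}(2,\mathbb{C})$ and $\Lambda = A\,\mathbb{Z}[i]^2\subseteq\mathbb{C}^2$. Let $B=\begin{pmatrix} a & c\\ b& d\end{pmatrix}$ have entries in $\mathbb{Z}[i]$, with $\Delta=\det B\neq 0$ and $|\gcd(a,c)|=1$. Let $\mathcal{D}$ be the set of coset representatives of $\mathbb{Z}[i]^2/B\,\mathbb{Z}[i]^2$ given in the context, let $\mathcal{D}=\mathcal{E}_0\cup\mathcal{E}_1\cup\mathcal{E}_2$ and $\mathcal{D}=\mathcal{E}_0'\cup\mathcal{E}_1'\cup\mathcal{E}_2'$ be partitions into disjoint (possibly empty) subsets where $$\mathcal{E}_0=\{(0,\delta)\in\mathcal{D}: c\delta/\Delta\in\mathbb{Z}[i]\},\qquad \mathcal{E}_0'=\{(0,\delta)\in\mathcal{D}: a\delta/\Delta\in\mathbb{Z}[i]\}$$ and the partitions of $\mathcal{D}\setminus\mathcal{E}_0$ into $\mathcal{E}_1,\mathcal{E}_2$ and of $\mathcal{D}\setminus\mathcal{E}_0'$ into $\mathcal{E}_1',\mathcal{E}_2'$ are arbitrary. Define the entire functions on $\mathbb{C}^2$ $$\sigma_\Lambda(z)=\sigma\big(p_1((AB)^{-1}z)\big)\prod_{\nu\in\mathcal{E}_1}\big(\beta_{p_1(B^{-1}\nu)}\sigma\big)\big(p_1((AB)^{-1}z)\big)\prod_{\nu\in\mathcal{E}_2}\big(\beta_{p_2(B^{-1}\nu)}\sigma\big)\big(p_2((AB)^{-1}z)\big)$$ and $$\tilde\sigma_\Lambda(z)=\sigma\big(p_2((AB)^{-1}z)\big)\prod_{\nu\in\mathcal{E}_1'}\big(\beta_{p_1(B^{-1}\nu)}\sigma\big)\big(p_1((AB)^{-1}z)\big)\prod_{\nu\in\mathcal{E}_2'}\big(\beta_{p_2(B^{-1}\nu)}\sigma\big)\big(p_2((AB)^{-1}z)\big).$$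 Then $\sigma_\Lambda$ and $\tilde\sigma_\Lambda$ vanish on $\Lambda$.
   Context: $\mathbb{Z}[i]=\mathbb{Z}+i\mathbb{Z}$ is the ring of Gaussian integers; greatest common divisors are taken in $\mathbb{Z}[i]$ and are determined up to multiplication by $\pm1,\pm i$. With $\gamma=\gcd(a,c)$ (here a unit) and $Q=[0,1)+i[0,1)\subseteq\mathbb{C}$, the set of coset representatives is $\mathcal{D}=\{(0,\delta): \delta\in\tfrac{\Delta}{\gamma}Q\cap\mathbb{Z}[i]\}$, where elements of $\mathbb{C}^2$ are regarded as column vectors. If $a,b,c,d\in\mathbb{Z}$ one may also take $\mathcal{D}=\{(0,\alpha+i\alpha'):\alpha,\alpha'\in\mathbb{Z},\ 0\leq\alpha,\alpha'<|\Delta|\}$. The maps $p_1,p_2:\mathbb{C}^2\to\mathbb{C}$ are the coordinate projections $p_j(z_1,z_2)=z_j$. The function $\sigma$ is the Weierstrass sigma-function of the lattice $\mathbb{Z}[i]$, $\sigma(w)=w\prod_{\lambda\in\mathbb{Z}[i]\setminus\{0\}}\left(1-\frac{w}{\lambda}\right)e^{\frac{w}{\lambda}+\frac12\frac{w^2}{\lambda^2}}$ for $w\in\mathbb{C}$, whose zero set is $\mathbb{Z}[i]$. For $\zeta\in\mathbb{C}$ and an entire function $f$ of one variable, the Fock shift is $\beta_\zeta f(w)=e^{\pi\bar\zeta w-\pi|\zeta|^2/2}f(w-\zeta)$. *)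

theory Defs
  imports "HOL-Analysis.Analysis"
begin

definition gauss_ints :: "complex set"
  where "gauss_ints = {z. Re z \<in> \<int> \<and> Im z \<in> \<int>}"

definition gauss_dvd :: "complex \<Rightarrow> complex \<Rightarrow> bool"
  where "gauss_dvd x y \<longleftrightarrow> (\<exists>k\<in>gauss_ints. y = x * k)"

text \<open>A greatest common divisor is only determined up to a unit, hence a predicate.\<close>

definition is_gauss_gcd :: "complex \<Rightarrow> complex \<Rightarrow> complex \<Rightarrow> bool"
  where "is_gauss_gcd g x y \<longleftrightarrow> g \<in> gauss_ints \<and> gauss_dvd g x \<and> gauss_dvd g y \<and>
    (\<forall>h\<in>gauss_ints. gauss_dvd h x \<and> gauss_dvd h y \<longrightarrow> gauss_dvd h g)"

definition gauss_vecs :: "(complex^2) set"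
  where "gauss_vecs = {m. \<forall>j. m $ j \<in> gauss_ints}"

definition unit_square :: "complex set"
  where "unit_square = {z. 0 \<le> Re z \<and> Re z < 1 \<and> 0 \<le> Im z \<and> Im z < 1}"

definition coset_reps :: "complex \<Rightarrow> complex \<Rightarrow> (complex^2) set"
  where "coset_reps \<Delta> \<gamma> =
    {vector [0, \<delta>] |\<delta>. \<delta> \<in> (\<lambda>q. \<Delta> / \<gamma> * q) ` unit_square \<inter> gauss_ints}"

definition coset_reps_int :: "complex \<Rightarrow> (complex^2) set"
  where "coset_reps_int \<Delta> =
    {vector [0, of_int \<alpha> + \<i> * of_int \<alpha>'] |\<alpha> \<alpha>' :: int.
      0 \<le> \<alpha> \<and> real_of_int \<alpha> < cmod \<Delta> \<and> 0 \<le> \<alpha>' \<and> real_of_int \<alpha>' < cmod \<Delta>}"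

text \<open>
  The product over the nonzero lattice points converges absolutely and is taken unconditionally,
  as the limit of the net of finite partial products.  (The library's infinite products
  are indexed by the natural numbers only.)
\<close>

definition weierstrass_sigma :: "complex \<Rightarrow> complex"
  where "weierstrass_sigma w = w * Lim (finite_subsets_at_top (gauss_ints - {0}))
    (\<lambda>F. \<Prod>l\<in>F. (1 - w / l) * exp (w / l + 1/2 * (w\<^sup>2 / l\<^sup>2)))"

definition fock_shift :: "complex \<Rightarrow> (complex \<Rightarrow> complex) \<Rightarrow> complex \<Rightarrow> complex"
  where "fock_shift \<zeta> f w =
    exp (of_real pi * cnj \<zeta> * w - of_real (pi * (cmod \<zeta>)\<^sup>2 / 2)) * f (w - \<zeta>)"

definition sigma_Lambda ::
  "complex^2^2 \<Rightarrow> complex^2^2 \<Rightarrow> (complex^2) set \<Rightarrow> (complex^2) set \<Rightarrow> complex^2 \<Rightarrow> complex"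
  where "sigma_Lambda A B E\<^sub>1 E\<^sub>2 z =
    weierstrass_sigma ((matrix_inv (A ** B) *v z) $ 1)
    * (\<Prod>\<nu>\<in>E\<^sub>1. fock_shift ((matrix_inv B *v \<nu>) $ 1) weierstrass_sigma ((matrix_inv (A ** B) *v z) $ 1))
    * (\<Prod>\<nu>\<in>E\<^sub>2. fock_shift ((matrix_inv B *v \<nu>) $ 2) weierstrass_sigma ((matrix_inv (A ** B) *v z) $ 2))"

definition sigma_tilde_Lambda ::
  "complex^2^2 \<Rightarrow> complex^2^2 \<Rightarrow> (complex^2) set \<Rightarrow> (complex^2) set \<Rightarrow> complex^2 \<Rightarrow> complex"
  where "sigma_tilde_Lambda A B E\<^sub>1 E\<^sub>2 z =
    weierstrass_sigma ((matrix_inv (A ** B) *v z) $ 2)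
    * (\<Prod>\<nu>\<in>E\<^sub>1. fock_shift ((matrix_inv B *v \<nu>) $ 1) weierstrass_sigma ((matrix_inv (A ** B) *v z) $ 1))
    * (\<Prod>\<nu>\<in>E\<^sub>2. fock_shift ((matrix_inv B *v \<nu>) $ 2) weierstrass_sigma ((matrix_inv (A ** B) *v z) $ 2))"

end

theory Submission
  imports Defs
begin

text \<open>
  Put \<open>w = (AB)\<^sup>-\<^sup>1z\<close> for \<open>z = Am\<close> with \<open>m\<close> a Gaussian integer vector, so that \<open>w = B\<^sup>-\<^sup>1m\<close>.
  If \<open>m = Bk + \<nu>\<close> with \<open>k\<close> a Gaussian integer vector and \<open>\<nu> = (0, \<delta>)\<close> in \<open>\<D>\<close>, then
  \<open>w - B\<^sup>-\<^sup>1\<nu> = k\<close>.  Both coordinates of \<open>k\<close> are therefore zeros of \<open>\<sigma>\<close>, and the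
  factor attached to \<open>\<nu>\<close> vanishes at \<open>w\<close>, whichever of the two coordinates it uses; this is why
  the partition of the remaining representatives may be arbitrary.  The representatives without a
  factor are taken care of by the leading one: since \<open>B\<^sup>-\<^sup>1\<nu> = (-c\<delta>/\<Delta>, a\<delta>/\<Delta>)\<close>, membership in \<open>\<E>\<^sub>0\<close> (in
  \<open>\<E>\<^sub>0'\<close>) says that the first (second) coordinate of \<open>w\<close> is itself a Gaussian integer.

  What remains is that \<open>\<D>\<close> meets every coset (\<open>coset_reps_cover\<close>).  A unit gcd of \<open>a\<close> and \<open>c\<close> gives a
  Bezout relation \<open>ax + cy = 1\<close>, by which the first coordinate of \<open>m\<close> can be cleared; and since
  \<open>B(-c, a) = (0, \<Delta>)\<close>, the second coordinate can then be changed by multiples of \<open>\<Delta>\<close>, that is, moved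
  into the square \<open>(\<Delta>/\<gamma>)Q\<close>.  For an integer matrix the second choice of representatives is the first
  one with \<open>\<gamma>\<close> the sign of \<open>\<Delta>\<close> (\<open>coset_reps_int_eq\<close>); hence the cover is proved with an arbitrary
  unit in place of \<open>\<gamma>\<close>.
\<close>

section \<open>Gaussian integers\<close>

lemma gauss_ints_0 [simp]: "0 \<in> gauss_ints"
  and gauss_ints_1 [simp]: "1 \<in> gauss_ints"
  by (auto simp: gauss_ints_def)

lemma gauss_ints_of_int [simp]: "of_int n \<in> gauss_ints"
  by (auto simp: gauss_ints_def)

lemma gauss_ints_add: "x \<in> gauss_ints \<Longrightarrow> y \<in> gauss_ints \<Longrightarrow> x + y \<in> gauss_ints"
  and gauss_ints_diff: "x \<in> gauss_ints \<Longrightarrow> y \<in> gauss_ints \<Longrightarrow> x - y \<in> gauss_ints"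
  and gauss_ints_mult: "x \<in> gauss_ints \<Longrightarrow> y \<in> gauss_ints \<Longrightarrow> x * y \<in> gauss_ints"
  and gauss_ints_minus: "x \<in> gauss_ints \<Longrightarrow> - x \<in> gauss_ints"
  and gauss_ints_cnj: "x \<in> gauss_ints \<Longrightarrow> cnj x \<in> gauss_ints"
  by (auto simp: gauss_ints_def)

lemmas gauss_ints_closed =
  gauss_ints_add gauss_ints_diff gauss_ints_mult gauss_ints_minus gauss_ints_cnj

lemma gauss_ints_eq: "gauss_ints = range (\<lambda>(m, n). Complex (of_int m) (of_int n))"
proof
  show "gauss_ints \<subseteq> range (\<lambda>(m, n). Complex (of_int m) (of_int n))"
  proof
    fix z assume "z \<in> gauss_ints"
    then obtain m n where "Re z = of_int m" "Im z = of_int n"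
      by (auto simp: gauss_ints_def elim!: Ints_cases)
    then show "z \<in> range (\<lambda>(m, n). Complex (of_int m) (of_int n))"
      by (intro image_eqI[of _ _ "(m, n)"]) (auto simp: complex_eq_iff)
  qed
qed (auto simp: gauss_ints_def)

lemma finite_gauss_ints_bounded: "finite {z \<in> gauss_ints. cmod z \<le> R}"
proof (rule finite_subset)
  show "{z \<in> gauss_ints. cmod z \<le> R}
    \<subseteq> (\<lambda>(m, n). Complex (of_int m) (of_int n)) ` ({-\<lceil>R\<rceil>..\<lceil>R\<rceil>} \<times> {-\<lceil>R\<rceil>..\<lceil>R\<rceil>})"
  proof
    fix z assume z: "z \<in> {z \<in> gauss_ints. cmod z \<le> R}"
    then obtain m n where mn: "z = Complex (of_int m) (of_int n)"
      by (auto simp: gauss_ints_eq)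
    have "\<bar>real_of_int m\<bar> \<le> R" "\<bar>real_of_int n\<bar> \<le> R"
      using z abs_Re_le_cmod[of z] abs_Im_le_cmod[of z] by (auto simp: mn)
    then have "m \<in> {-\<lceil>R\<rceil>..\<lceil>R\<rceil>}" "n \<in> {-\<lceil>R\<rceil>..\<lceil>R\<rceil>}"
      by (auto; linarith)+
    then show "z \<in> (\<lambda>(m, n). Complex (of_int m) (of_int n)) ` ({-\<lceil>R\<rceil>..\<lceil>R\<rceil>} \<times> {-\<lceil>R\<rceil>..\<lceil>R\<rceil>})"
      unfolding mn by (intro image_eqI[of _ _ "(m, n)"]) auto
  qed
qed auto

lemma ex_gauss_int_near: "\<exists>q\<in>gauss_ints. cmod (z - q) < 1"
proof (rule bexI)
  define q where "q = Complex (of_int (round (Re z))) (of_int (round (Im z)))"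
  show "q \<in> gauss_ints"
    by (auto simp: gauss_ints_def q_def)
  have "\<bar>Re (z - q)\<bar> \<le> 1/2" "\<bar>Im (z - q)\<bar> \<le> 1/2"
    using of_int_round_abs_le[of "Re z"] of_int_round_abs_le[of "Im z"]
    by (auto simp: q_def abs_minus_commute)
  then have "(Re (z - q))\<^sup>2 \<le> (1/2)\<^sup>2" "(Im (z - q))\<^sup>2 \<le> (1/2)\<^sup>2"
    by (auto simp: abs_le_square_iff[symmetric])
  then have "(cmod (z - q))\<^sup>2 < 1\<^sup>2"
    by (simp add: cmod_power2 power_divide)
  then show "cmod (z - q) < 1"
    by (rule power2_less_imp_less) simp
qed

lemma ex_gauss_floor: "\<exists>q\<in>gauss_ints. z - q \<in> unit_square"
proof (rule bexI)
  show "z - Complex (of_int \<lfloor>Re z\<rfloor>) (of_int \<lfloor>Im z\<rfloor>) \<in> unit_square"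
    by (auto simp: unit_square_def; linarith)
qed (auto simp: gauss_ints_def)

lemma cmod_square_gauss_int: "x \<in> gauss_ints \<Longrightarrow> (cmod x)\<^sup>2 = real (nat \<lfloor>(cmod x)\<^sup>2\<rfloor>)"
proof -
  assume "x \<in> gauss_ints"
  then have "(cmod x)\<^sup>2 \<in> \<int>"
    by (auto simp: cmod_power2 gauss_ints_def)
  then obtain n where n: "(cmod x)\<^sup>2 = of_int n"
    by (rule Ints_cases)
  moreover have "0 \<le> n"
    using zero_le_power2[of "cmod x"] unfolding n by simp
  ultimately show ?thesis by simp
qed

text \<open>
  The Euclidean argument: a nonzero element of least norm in the ideal generated by \<open>a\<close> and \<open>c\<close>
  divides every element of that ideal, because a remainder is again in the ideal and has smaller
  norm.
\<close>

lemma gauss_bezout: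
  assumes "a \<in> gauss_ints" "c \<in> gauss_ints" "a \<noteq> 0 \<or> c \<noteq> 0"
  obtains x y where "x \<in> gauss_ints" "y \<in> gauss_ints"
    "gauss_dvd (a * x + c * y) a" "gauss_dvd (a * x + c * y) c"
proof -
  define I where "I = {a * x + c * y |x y. x \<in> gauss_ints \<and> y \<in> gauss_ints}"
  define norm2 where "norm2 x = nat \<lfloor>(cmod x)\<^sup>2\<rfloor>" for x
  have I_sub: "I \<subseteq> gauss_ints"
    using assms by (auto simp: I_def intro!: gauss_ints_closed)
  have "a * 1 + c * 0 \<in> I" "a * 0 + c * 1 \<in> I"
    unfolding I_def by (blast intro: gauss_ints_0 gauss_ints_1)+
  then have aI: "a \<in> I" and cI: "c \<in> I" by simp_all
  then have "\<exists>g. g \<in> I \<and> g \<noteq> 0"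
    using assms(3) by blast
  then obtain g where g: "g \<in> I" "g \<noteq> 0" and min: "\<And>h. h \<in> I \<Longrightarrow> h \<noteq> 0 \<Longrightarrow> norm2 g \<le> norm2 h"
    using ex_has_least_nat[of "\<lambda>g. g \<in> I \<and> g \<noteq> 0" _ norm2] by blast
  obtain x y where xy: "x \<in> gauss_ints" "y \<in> gauss_ints" "g = a * x + c * y"
    using g(1) by (auto simp: I_def)
  have dvd: "gauss_dvd g h" if h: "h \<in> I" for h
  proof -
    obtain q where q: "q \<in> gauss_ints" "cmod (h / g - q) < 1"
      using ex_gauss_int_near by blast
    define r where "r = h - g * q"
    obtain s t where st: "s \<in> gauss_ints" "t \<in> gauss_ints" "h = a * s + c * t"
      using h by (auto simp: I_def)
    have "r = a * (s - x * q) + c * (t - y * q)"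
      by (simp add: r_def xy st algebra_simps)
    then have rI: "r \<in> I"
      unfolding I_def using xy st q(1) by (blast intro: gauss_ints_closed)
    have "r = g * (h / g - q)"
      using g(2) by (simp add: r_def algebra_simps)
    then have "cmod r = cmod g * cmod (h / g - q)"
      by (simp only: norm_mult)
    then have "cmod r < cmod g"
      using q(2) g(2) by simp
    then have "(cmod r)\<^sup>2 < (cmod g)\<^sup>2"
      by (intro power_strict_mono) auto
    moreover have "r \<in> gauss_ints" "g \<in> gauss_ints"
      using rI g(1) I_sub by auto
    ultimately have "norm2 r < norm2 g"
      unfolding norm2_def by (metis cmod_square_gauss_int of_nat_less_iff)
    then have "r = 0"
      using min[OF rI] by (meson not_le)
    then show ?thesis
      using q(1) by (auto simp: gauss_dvd_def r_def)
  qed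
  show thesis
    using that[OF xy(1,2)] dvd[OF aI] dvd[OF cI] by (simp add: xy(3))
qed

lemma unimodular_mult_cnj: "cmod u = 1 \<Longrightarrow> u * cnj u = 1"
  by (simp add: complex_norm_square[symmetric])

lemma gauss_coprime_bezout:
  assumes "a \<in> gauss_ints" "c \<in> gauss_ints" "a \<noteq> 0 \<or> c \<noteq> 0"
    and "is_gauss_gcd \<gamma> a c" "cmod \<gamma> = 1"
  obtains x y where "x \<in> gauss_ints" "y \<in> gauss_ints" "a * x + c * y = 1"
proof -
  obtain x y where xy: "x \<in> gauss_ints" "y \<in> gauss_ints"
    "gauss_dvd (a * x + c * y) a" "gauss_dvd (a * x + c * y) c"
    using gauss_bezout[OF assms(1-3)] by blast
  have \<gamma>: "\<gamma> \<in> gauss_ints"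
    using assms(4) by (simp add: is_gauss_gcd_def)
  have "a * x + c * y \<in> gauss_ints"
    using assms xy by (intro gauss_ints_closed)
  then have "gauss_dvd (a * x + c * y) \<gamma>"
    using assms(4) xy by (auto simp: is_gauss_gcd_def)
  then obtain k where k: "k \<in> gauss_ints" "\<gamma> = (a * x + c * y) * k"
    by (auto simp: gauss_dvd_def)
  have "a * (x * (k * cnj \<gamma>)) + c * (y * (k * cnj \<gamma>)) = (a * x + c * y) * k * cnj \<gamma>"
    by (simp add: algebra_simps)
  also have "\<dots> = 1"
    using unimodular_mult_cnj[OF assms(5)] k(2) by simp
  finally have "a * (x * (k * cnj \<gamma>)) + c * (y * (k * cnj \<gamma>)) = 1" .
  moreover have "x * (k * cnj \<gamma>) \<in> gauss_ints" "y * (k * cnj \<gamma>) \<in> gauss_ints"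
    using k(1) \<gamma> xy(1,2) by (simp_all add: gauss_ints_closed)
  ultimately show thesis
    using that by blast
qed

section \<open>Zeros of the sigma function\<close>

text \<open>
  At a nonzero lattice point \<open>w\<close> every finite partial product that includes the factor of \<open>w\<close>
  is zero, so the net of partial products is eventually constant.
\<close>

lemma weierstrass_sigma_gauss_int:
  assumes "w \<in> gauss_ints"
  shows "weierstrass_sigma w = 0"
proof (cases "w = 0")
  case False
  let ?P = "\<lambda>F. \<Prod>l\<in>F. (1 - w / l) * exp (w / l + 1/2 * (w\<^sup>2 / l\<^sup>2))"
  let ?U = "finite_subsets_at_top (gauss_ints - {0})"
  have "\<forall>\<^sub>F F in ?U. finite F \<and> {w} \<subseteq> F"
    unfolding eventually_finite_subsets_at_top using assms False
    by (intro exI[of _ "{w}"]) auto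
  then have "\<forall>\<^sub>F F in ?U. ?P F = 0"
    by eventually_elim (use False in \<open>auto intro!: prod_zero\<close>)
  then have "(?P \<longlongrightarrow> 0) ?U"
    by (rule tendsto_eventually)
  then have "Lim ?U ?P = 0"
    by (intro tendsto_Lim) auto
  then show ?thesis
    by (simp add: weierstrass_sigma_def)
qed (simp add: weierstrass_sigma_def)

lemma fock_shift_sigma_zero:
  "w - \<zeta> \<in> gauss_ints \<Longrightarrow> fock_shift \<zeta> weierstrass_sigma w = 0"
  by (simp add: fock_shift_def weierstrass_sigma_gauss_int)

section \<open>Coset representatives\<close>

text \<open>
  Dividing a real \<open>\<Delta>\<close> by its sign leaves \<open>\<bar>\<Delta>\<bar>\<close>, and a positive multiple of the unit square is cut out
  by inequalities on the real and the imaginary part separately.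
\<close>

lemma coset_reps_int_eq:
  assumes "Im \<Delta> = 0" "\<Delta> \<noteq> 0"
  shows "coset_reps_int \<Delta> = coset_reps \<Delta> (sgn \<Delta>)"
proof -
  have quot: "\<Delta> / sgn \<Delta> = of_real (cmod \<Delta>)"
    using assms(2) by (simp add: sgn_eq)
  have pos: "0 < cmod \<Delta>"
    using assms(2) by simp
  have square: "z \<in> (\<lambda>q. of_real (cmod \<Delta>) * q) ` unit_square \<longleftrightarrow>
      0 \<le> Re z \<and> Re z < cmod \<Delta> \<and> 0 \<le> Im z \<and> Im z < cmod \<Delta>" for z
  proof
    assume "0 \<le> Re z \<and> Re z < cmod \<Delta> \<and> 0 \<le> Im z \<and> Im z < cmod \<Delta>"
    then have "z / of_real (cmod \<Delta>) \<in> unit_square"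
      using pos by (auto simp: unit_square_def Re_divide_of_real Im_divide_of_real)
    moreover have "z = of_real (cmod \<Delta>) * (z / of_real (cmod \<Delta>))"
      using pos by simp
    ultimately show "z \<in> (\<lambda>q. of_real (cmod \<Delta>) * q) ` unit_square"
      by blast
  qed (use pos in \<open>auto simp: unit_square_def\<close>)
  have form: "of_int \<alpha> + \<i> * of_int \<alpha>' = Complex (of_int \<alpha>) (of_int \<alpha>')" for \<alpha> \<alpha>'
    by (simp add: complex_eq_iff)
  show ?thesis
    unfolding coset_reps_int_def coset_reps_def quot square Int_iff form gauss_ints_eq
    by fastforce
qed

lemma finite_coset_reps: "finite (coset_reps \<Delta> \<gamma>)"
proof -
  have "cmod (\<Delta> / \<gamma> * q) \<le> cmod (\<Delta> / \<gamma>) * 2" if "q \<in> unit_square" for q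
  proof -
    have "cmod q \<le> \<bar>Re q\<bar> + \<bar>Im q\<bar>"
      by (rule cmod_le)
    then have "cmod q \<le> 2"
      using that by (auto simp: unit_square_def)
    then show ?thesis
      unfolding norm_mult by (intro mult_left_mono) auto
  qed
  then have "coset_reps \<Delta> \<gamma>
      \<subseteq> (\<lambda>\<delta>. vector [0, \<delta>]) ` {\<delta> \<in> gauss_ints. cmod \<delta> \<le> cmod (\<Delta> / \<gamma>) * 2}"
    by (auto simp: coset_reps_def)
  then show ?thesis
    using finite_gauss_ints_bounded finite_subset by blast
qed

lemma matrix_2_mult_vector:
  "(vector [vector [a, c], vector [b, d]] :: complex^2^2) *v v
     = vector [a * v $ 1 + c * v $ 2, b * v $ 1 + d * v $ 2]"
  by (simp add: vec_eq_iff forall_2 matrix_vector_mult_def sum_2)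

text \<open>
  The witness is \<open>k = m\<^sub>1(x, y) + t(-c, a)\<close>: the first summand matches the first coordinate of \<open>m\<close>, and
  the second changes only the second coordinate of \<open>Bk\<close>, by \<open>t det B\<close>.  Any unit \<open>u\<close> will do, because
  \<open>det B / u\<close> and \<open>det B\<close> have the same Gaussian multiples.
\<close>

lemma coset_reps_cover:
  assumes "a \<in> gauss_ints" "b \<in> gauss_ints" "c \<in> gauss_ints" "d \<in> gauss_ints"
    and B: "B = vector [vector [a, c], vector [b, d]]"
    and "det B \<noteq> 0"
    and bezout: "x \<in> gauss_ints" "y \<in> gauss_ints" "a * x + c * y = 1"
    and u: "u \<in> gauss_ints" "cmod u = 1"
    and m: "m \<in> gauss_vecs"
  obtains k \<nu> where "k \<in> gauss_vecs" "\<nu> \<in> coset_reps (det B) u" "m = B *v k + \<nu>"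
proof -
  have det: "det B = a * d - c * b"
    by (simp add: B det_2)
  have m12: "m $ 1 \<in> gauss_ints" "m $ 2 \<in> gauss_ints"
    using m by (auto simp: gauss_vecs_def)
  have unz: "u \<noteq> 0"
    using u(2) by auto
  define \<delta>\<^sub>0 where "\<delta>\<^sub>0 = m $ 2 - (b * (x * m $ 1) + d * (y * m $ 1))"
  obtain q where q: "q \<in> gauss_ints" "\<delta>\<^sub>0 / (det B / u) - q \<in> unit_square"
    using ex_gauss_floor by blast
  \<comment> \<open>As \<open>1 / u\<close> is \<open>cnj u\<close>, this makes \<open>q\<close> times \<open>det B / u\<close> equal to \<open>t\<close> times \<open>det B\<close>.\<close>
  define t where "t = cnj u * q"
  define k :: "complex^2" where "k = vector [x * m $ 1 - c * t, y * m $ 1 + a * t]"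
  define \<delta> where "\<delta> = \<delta>\<^sub>0 - det B * t"
  have t: "t \<in> gauss_ints"
    using u q by (simp add: t_def gauss_ints_closed)
  have \<delta>: "\<delta> \<in> gauss_ints"
    using assms(1-4) bezout m12 t unfolding \<delta>_def \<delta>\<^sub>0_def det by (intro gauss_ints_closed)
  have "det B / u * (\<delta>\<^sub>0 / (det B / u) - q) = \<delta>\<^sub>0 - det B * (q / u)"
    using assms(6) unz by (simp add: field_simps)
  also have "q / u = t"
    using unimodular_mult_cnj[OF u(2)] unz by (simp add: t_def field_simps)
  finally have "\<delta> \<in> (\<lambda>q. det B / u * q) ` unit_square"
    using q(2) by (auto simp: \<delta>_def intro: rev_image_eqI)
  then have "vector [0, \<delta>] \<in> coset_reps (det B) u"
    using \<delta> by (auto simp: coset_reps_def)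
  moreover have "k \<in> gauss_vecs"
    using assms(1-4) bezout m12 t
    by (auto simp: gauss_vecs_def k_def forall_2 intro!: gauss_ints_closed)
  moreover have "m = B *v k + vector [0, \<delta>]"
  proof -
    have "a * (x * m $ 1 - c * t) + c * (y * m $ 1 + a * t) = (a * x + c * y) * m $ 1"
      by (simp add: algebra_simps)
    then have "a * (x * m $ 1 - c * t) + c * (y * m $ 1 + a * t) = m $ 1"
      by (simp add: bezout(3))
    moreover have "b * (x * m $ 1 - c * t) + d * (y * m $ 1 + a * t) + \<delta> = m $ 2"
      by (simp add: \<delta>_def \<delta>\<^sub>0_def det algebra_simps)
    ultimately show ?thesis
      by (simp add: B matrix_2_mult_vector k_def vec_eq_iff forall_2)
  qed
  ultimately show thesis
    using that by blast
qed

section \<open>Vanishing on the lattice\<close>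

lemma matrix_inv_mult_cancel:
  fixes M :: "'a::field^'n^'n"
  assumes "invertible M"
  shows "matrix_inv M *v (M *v v) = v" "M *v (matrix_inv M *v v) = v"
proof -
  have "M ** matrix_inv M = mat 1 \<and> matrix_inv M ** M = mat 1"
    using assms unfolding invertible_def matrix_inv_def by (rule someI_ex)
  then show "matrix_inv M *v (M *v v) = v" "M *v (matrix_inv M *v v) = v"
    by (simp_all add: matrix_vector_mul_assoc)
qed

lemma matrix_inv_2_mult_vector:
  fixes B :: "complex^2^2"
  assumes B: "B = vector [vector [a, c], vector [b, d]]" and "det B \<noteq> 0"
  shows "matrix_inv B *v vector [0, \<delta>] = vector [- (c * \<delta> / det B), a * \<delta> / det B]"
proof -
  have det: "det B = a * d - c * b"
    by (simp add: B det_2)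
  have "(a * d - c * b) * \<delta> / det B = \<delta>"
    using assms(2) by (simp add: det)
  then have "B *v vector [- (c * \<delta> / det B), a * \<delta> / det B] = vector [0, \<delta>]"
    unfolding B matrix_2_mult_vector vec_eq_iff forall_2
    by (simp add: diff_divide_distrib algebra_simps)
  then show ?thesis
    using matrix_inv_mult_cancel(1)[of B] assms(2) by (metis invertible_det_nz)
qed

text \<open>
  The common part of both claims.  The leading factor of the product uses the coordinate \<open>j\<close>, and
  it has to vanish only when the coset of \<open>m\<close> is represented outside \<open>E\<^sub>1 \<union> E\<^sub>2\<close>.  Finiteness is
  needed because a product over an infinite set is \<open>1\<close> by convention.
\<close>

lemma shifted_sigma_product_zero:
  fixes B :: "complex^2^2"
  assumes "invertible B" "finite (E\<^sub>1 \<union> E\<^sub>2)"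
    and k: "k \<in> gauss_vecs"
    and w: "w = matrix_inv B *v (B *v k + \<nu>)"
    and rest: "\<nu> \<notin> E\<^sub>1 \<union> E\<^sub>2 \<Longrightarrow> (matrix_inv B *v \<nu>) $ j \<in> gauss_ints"
  shows "weierstrass_sigma (w $ j)
    * (\<Prod>\<nu>\<in>E\<^sub>1. fock_shift ((matrix_inv B *v \<nu>) $ 1) weierstrass_sigma (w $ 1))
    * (\<Prod>\<nu>\<in>E\<^sub>2. fock_shift ((matrix_inv B *v \<nu>) $ 2) weierstrass_sigma (w $ 2)) = 0"
proof -
  have "w = k + matrix_inv B *v \<nu>"
    by (simp add: w matrix_vector_right_distrib matrix_inv_mult_cancel(1) assms(1))
  then have diff: "w $ i - (matrix_inv B *v \<nu>) $ i = k $ i" for i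
    by simp
  then have shift: "fock_shift ((matrix_inv B *v \<nu>) $ i) weierstrass_sigma (w $ i) = 0" for i
    using k by (intro fock_shift_sigma_zero) (simp add: gauss_vecs_def)
  consider "\<nu> \<in> E\<^sub>1" | "\<nu> \<in> E\<^sub>2" | "\<nu> \<notin> E\<^sub>1 \<union> E\<^sub>2"
    by blast
  then show ?thesis
  proof cases
    case 1
    then have "(\<Prod>\<nu>\<in>E\<^sub>1. fock_shift ((matrix_inv B *v \<nu>) $ 1) weierstrass_sigma (w $ 1)) = 0"
      using assms(2) shift by (intro prod_zero) auto
    then show ?thesis by simp
  next
    case 2
    then have "(\<Prod>\<nu>\<in>E\<^sub>2. fock_shift ((matrix_inv B *v \<nu>) $ 2) weierstrass_sigma (w $ 2)) = 0"
      using assms(2) shift by (intro prod_zero) auto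
    then show ?thesis by simp
  next
    case 3
    have "w $ j = k $ j + (matrix_inv B *v \<nu>) $ j"
      using diff[of j] by (simp add: algebra_simps)
    then have "w $ j \<in> gauss_ints"
      using rest[OF 3] k by (simp add: gauss_vecs_def gauss_ints_add)
    then show ?thesis
      by (simp add: weierstrass_sigma_gauss_int)
  qed
qed

theorem proposition3p2:
  fixes A B :: "complex^2^2"
    and a b c d \<Delta> \<gamma> :: complex
    and \<Lambda> \<D> \<E>\<^sub>0 \<E>\<^sub>1 \<E>\<^sub>2 \<E>\<^sub>0' \<E>\<^sub>1' \<E>\<^sub>2' :: "(complex^2) set"
  assumes "invertible A"
    and "\<Lambda> = (\<lambda>m. A *v m) ` gauss_vecs"
    and "a \<in> gauss_ints" "b \<in> gauss_ints" "c \<in> gauss_ints" "d \<in> gauss_ints"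
    and "B = vector [vector [a, c], vector [b, d]]"
    and "\<Delta> = det B" "\<Delta> \<noteq> 0"
    and "is_gauss_gcd \<gamma> a c" "cmod \<gamma> = 1"
    and "\<D> = coset_reps \<Delta> \<gamma> \<or>
         a \<in> \<int> \<and> b \<in> \<int> \<and> c \<in> \<int> \<and> d \<in> \<int> \<and> \<D> = coset_reps_int \<Delta>"
    and "\<E>\<^sub>0 = {\<nu> \<in> \<D>. \<exists>\<delta>. \<nu> = vector [0, \<delta>] \<and> c * \<delta> / \<Delta> \<in> gauss_ints}"
    and "\<E>\<^sub>0' = {\<nu> \<in> \<D>. \<exists>\<delta>. \<nu> = vector [0, \<delta>] \<and> a * \<delta> / \<Delta> \<in> gauss_ints}"
    and "\<E>\<^sub>1 \<union> \<E>\<^sub>2 = \<D> - \<E>\<^sub>0" "\<E>\<^sub>1 \<inter> \<E>\<^sub>2 = {}"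
    and "\<E>\<^sub>1' \<union> \<E>\<^sub>2' = \<D> - \<E>\<^sub>0'" "\<E>\<^sub>1' \<inter> \<E>\<^sub>2' = {}"
  shows "(\<forall>z\<in>\<Lambda>. sigma_Lambda A B \<E>\<^sub>1 \<E>\<^sub>2 z = 0) \<and>
         (\<forall>z\<in>\<Lambda>. sigma_tilde_Lambda A B \<E>\<^sub>1' \<E>\<^sub>2' z = 0)"
proof -
  note B = assms(7)
  have detB: "det B \<noteq> 0" and det: "det B = a * d - c * b"
    using assms(8,9) by (auto simp: B det_2)
  have invB: "invertible B"
    using detB by (simp add: invertible_det_nz)
  have \<gamma>: "\<gamma> \<in> gauss_ints"
    using assms(10) by (simp add: is_gauss_gcd_def)
  have "a \<noteq> 0 \<or> c \<noteq> 0"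
    using detB det by auto
  then obtain x y where bezout: "x \<in> gauss_ints" "y \<in> gauss_ints" "a * x + c * y = 1"
    using gauss_coprime_bezout assms(3,5,10,11) by blast
  obtain u where u: "u \<in> gauss_ints" "cmod u = 1" "\<D> = coset_reps (det B) u"
    using assms(12)
  proof
    assume "\<D> = coset_reps \<Delta> \<gamma>"
    then show thesis
      using that \<gamma> assms(8,11) by blast
  next
    assume int: "a \<in> \<int> \<and> b \<in> \<int> \<and> c \<in> \<int> \<and> d \<in> \<int> \<and> \<D> = coset_reps_int \<Delta>"
    then have "\<Delta> \<in> \<int>"
      by (simp add: assms(8) det)
    then obtain n where n: "\<Delta> = of_int n"
      by (rule Ints_cases)
    have "sgn \<Delta> = of_int (sgn n)"
      using assms(9) by (auto simp: n sgn_eq sgn_if)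
    then have "sgn \<Delta> \<in> gauss_ints"
      by simp
    moreover have "cmod (sgn \<Delta>) = 1"
      using assms(9) by (simp add: norm_sgn)
    moreover have "\<D> = coset_reps \<Delta> (sgn \<Delta>)"
      using int coset_reps_int_eq[of \<Delta>] assms(9) by (simp add: n)
    ultimately show thesis
      using that assms(8) by blast
  qed
  have fin: "finite \<D>"
    by (simp add: u(3) finite_coset_reps)
  have "sigma_Lambda A B \<E>\<^sub>1 \<E>\<^sub>2 z = 0 \<and> sigma_tilde_Lambda A B \<E>\<^sub>1' \<E>\<^sub>2' z = 0" if z: "z \<in> \<Lambda>" for z
  proof -
    obtain m where m: "m \<in> gauss_vecs" "z = A *v m"
      using z assms(2) by blast
    obtain k \<nu> where k: "k \<in> gauss_vecs" and \<nu>: "\<nu> \<in> \<D>" and mk: "m = B *v k + \<nu>"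
      using coset_reps_cover[OF assms(3-6) B detB bezout u(1,2) m(1)] u(3) by blast
    have "B *v (matrix_inv B *v m) = m"
      by (rule matrix_inv_mult_cancel(2)[OF invB])
    then have "(A ** B) *v (matrix_inv B *v m) = z"
      by (simp add: m(2) matrix_vector_mul_assoc[symmetric])
    moreover have "invertible (A ** B)"
      using assms(1) invB by (rule invertible_mult)
    ultimately have w: "matrix_inv (A ** B) *v z = matrix_inv B *v (B *v k + \<nu>)"
      using matrix_inv_mult_cancel(1) mk by metis
    obtain \<delta> where \<delta>: "\<nu> = vector [0, \<delta>]"
      using \<nu> by (auto simp: u(3) coset_reps_def)
    have inv\<nu>: "matrix_inv B *v \<nu> = vector [- (c * \<delta> / \<Delta>), a * \<delta> / \<Delta>]"
      unfolding \<delta> assms(8) by (rule matrix_inv_2_mult_vector[OF B detB])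
    have "sigma_Lambda A B \<E>\<^sub>1 \<E>\<^sub>2 z = 0"
      unfolding sigma_Lambda_def
    proof (rule shifted_sigma_product_zero[OF invB _ k w])
      show "finite (\<E>\<^sub>1 \<union> \<E>\<^sub>2)"
        using fin assms(15) by simp
      assume "\<nu> \<notin> \<E>\<^sub>1 \<union> \<E>\<^sub>2"
      then have "\<nu> \<in> \<E>\<^sub>0"
        using \<nu> assms(15) by blast
      then have "c * \<delta> / \<Delta> \<in> gauss_ints"
        unfolding assms(13) \<delta> by (auto simp: vec_eq_iff forall_2)
      then show "(matrix_inv B *v \<nu>) $ 1 \<in> gauss_ints"
        unfolding inv\<nu> by (simp add: gauss_ints_minus)
    qed
    moreover have "sigma_tilde_Lambda A B \<E>\<^sub>1' \<E>\<^sub>2' z = 0"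
      unfolding sigma_tilde_Lambda_def
    proof (rule shifted_sigma_product_zero[OF invB _ k w])
      show "finite (\<E>\<^sub>1' \<union> \<E>\<^sub>2')"
        using fin assms(17) by simp
      assume "\<nu> \<notin> \<E>\<^sub>1' \<union> \<E>\<^sub>2'"
      then have "\<nu> \<in> \<E>\<^sub>0'"
        using \<nu> assms(17) by blast
      then have "a * \<delta> / \<Delta> \<in> gauss_ints"
        unfolding assms(14) \<delta> by (auto simp: vec_eq_iff forall_2)
      then show "(matrix_inv B *v \<nu>) $ 2 \<in> gauss_ints"
        unfolding inv\<nu> by simp
    qed
    ultimately show ?thesis ..
  qed
  then show ?thesis by blast
qed

end
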